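(* Let $x_0\in\mathbb{R}^d$ and let $f=(f_1,\dots,f_K):\mathbb{R}^d\to\mathbb{R}^K$ be a multi-class classifier with continuously differentiable components $f_i$. Let $c=\operatorname{argmax}_{1\le i\le K} f_i(x_0)$ be the class which $f$ predicts for $x_0$. Let $1\le p,q\le\infty$ with $\frac1p+\frac1q=1$, and for each $j\ne c$ let $L_q^j$ be the Lipschitz constant of the function $f_c(x)-f_j(x)$ in $\ell_p$ norm. Then for all $\delta\in\mathbb{R}^d$ with $$\|\delta\|_p\le \min_{j\ne c}\frac{f_c(x_0)-f_j(x_0)}{L_q^j},$$ $\operatorname{argmax}_{1\le i\le K} f_i(x_0+\delta)=c$ holds. In other words, $\beta_L=\min_{j\ne c}\frac{f_c(x_0)-f_j(x_0)}{L_q^j}$ is a lower bound of the minimum $\ell_p$ adversarial distortion of $x_0$.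
   Context: The prediction of the classifier at $x$ is $c(x)=\operatorname{argmax}_{1\le i\le K} f_i(x)$. That $L_q^j$ is the Lipschitz constant of $g=f_c-f_j$ in $\ell_p$ norm means that $g$ is assumed Lipschitz continuous with $|g(x)-g(y)|\le L_q^j\|x-y\|_p$ for all $x,y$. A perturbed example of $x_0$ with noise $\delta\in\mathbb{R}^d$ is $x_a=x_0+\delta$, with $\ell_p$-distortion $\|\delta\|_p$; it is an adversarial example if it changes the prediction, i.e. $c(x_a)\ne c(x_0)$. The minimum adversarial distortion $\Delta_{p,\min}$ of $x_0$ is the smallest $\ell_p$-distortion over all adversarial examples of $x_0$. A lower bound of $\Delta_{p,\min}$ is a number $\beta_L\le\Delta_{p,\min}$ such that no perturbed example of $x_0$ with $\|\delta\|_p\le\beta_L$ is an adversarial example. *)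

theory Defs
  imports "HOL-Analysis.Analysis"
begin

text \<open>Meaningful for \<open>1 \<le> p\<close>, where \<open>p = \<infinity>\<close> gives the maximum norm.\<close>

definition lp_norm :: "ereal \<Rightarrow> real ^ 'd \<Rightarrow> real" where
  "lp_norm p x =
     (if p = \<infinity> then infnorm x
      else (\<Sum>i\<in>UNIV. \<bar>x $ i\<bar> powr real_of_ereal p) powr (1 / real_of_ereal p))"

definition lp_Lipschitz :: "ereal \<Rightarrow> (real ^ 'd \<Rightarrow> real) \<Rightarrow> real \<Rightarrow> bool" where
  "lp_Lipschitz p g L \<longleftrightarrow> (\<forall>x y. \<bar>g x - g y\<bar> \<le> L * lp_norm p (x - y))"

definition cont_differentiable :: "(real ^ 'd \<Rightarrow> real) \<Rightarrow> bool" where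
  "cont_differentiable g \<longleftrightarrow>
     (\<exists>g' :: real ^ 'd \<Rightarrow> ((real ^ 'd) \<Rightarrow>\<^sub>L real).
        (\<forall>x. (g has_derivative blinfun_apply (g' x)) (at x)) \<and> continuous_on UNIV g')"

text \<open>
  \<open>predicts f x c\<close> reads \<open>argmax\<^sub>i f\<^sub>i(x) = c\<close> as: the class \<open>c\<close> attains the maximum.
  At a point with ties every maximizing class counts as predicted. This matters because the
  certified ball is closed: on its boundary \<open>f\<^sub>c\<close> can tie with another component, so the
  bound would fail there for a fixed tie-breaking rule or for uniqueness of the maximizer.
\<close>

definition predicts :: "(real ^ 'd \<Rightarrow> real ^ 'k) \<Rightarrow> real ^ 'd \<Rightarrow> 'k \<Rightarrow> bool" where
  "predicts f x c \<longleftrightarrow> is_arg_max (\<lambda>i. f x $ i) (\<lambda>_. True) c"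

text \<open>In the following, \<open>c\<close> is the class which \<open>f\<close> predicts for \<open>x0\<close>.\<close>

definition adversarial ::
  "(real ^ 'd \<Rightarrow> real ^ 'k) \<Rightarrow> 'k \<Rightarrow> real ^ 'd \<Rightarrow> real ^ 'd \<Rightarrow> bool" where
  "adversarial f c x0 \<delta> \<longleftrightarrow> \<not> predicts f (x0 + \<delta>) c"

text \<open>
  An infimum, since adversarial examples form an open set for continuous \<open>f\<close> and a smallest
  distortion need not be attained. It is \<open>\<infinity>\<close> if there are no adversarial examples.
\<close>

definition min_adv_distortion ::
  "ereal \<Rightarrow> (real ^ 'd \<Rightarrow> real ^ 'k) \<Rightarrow> 'k \<Rightarrow> real ^ 'd \<Rightarrow> ereal" where
  "min_adv_distortion p f c x0 = (INF \<delta>\<in>{\<delta>. adversarial f c x0 \<delta>}. ereal (lp_norm p \<delta>))"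

definition adv_lower_bound ::
  "ereal \<Rightarrow> (real ^ 'd \<Rightarrow> real ^ 'k) \<Rightarrow> 'k \<Rightarrow> real ^ 'd \<Rightarrow> ereal \<Rightarrow> bool" where
  "adv_lower_bound p f c x0 \<beta> \<longleftrightarrow>
     \<beta> \<le> min_adv_distortion p f c x0 \<and>
     (\<forall>\<delta>. ereal (lp_norm p \<delta>) \<le> \<beta> \<longrightarrow> \<not> adversarial f c x0 \<delta>)"

text \<open>
  The minimum over \<open>j \<noteq> c\<close> of the margins divided by the Lipschitz constants. Division is done
  in the extended reals: there \<open>a / 0 = \<infinity>\<close> for \<open>a > 0\<close>, so a class \<open>j\<close> with Lipschitz
  constant 0 and positive margin imposes no constraint, whereas real division would give 0;
  \<open>0 / 0\<close> is 0. The index set is finite, so the infimum is the minimum; it is \<open>\<infinity>\<close>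
  if \<open>c\<close> is the only class.
\<close>

definition margin_bound ::
  "(real ^ 'd \<Rightarrow> real ^ 'k) \<Rightarrow> 'k \<Rightarrow> ('k \<Rightarrow> real) \<Rightarrow> real ^ 'd \<Rightarrow> ereal" where
  "margin_bound f c L x0 = (INF j\<in>{j. j \<noteq> c}. ereal (f x0 $ c - f x0 $ j) / ereal (L j))"

end

theory Submission
  imports Defs
begin

text \<open>For a class \<open>j\<close> other than \<open>c\<close>, the margin
  \<open>g = f_c - f_j\<close> is nonnegative at \<open>x0\<close>. A shift by
  \<open>\<delta>\<close> lowers it by at most \<open>L j * lp_norm p \<delta>\<close>, and the
  radius is chosen so that this loss does not exceed \<open>g x0\<close>; hence \<open>g\<close>
  stays nonnegative (\<open>lp_Lipschitz_nonneg_add\<close>). Doing this for every \<open>j\<close>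
  keeps \<open>c\<close> a maximizer (\<open>predicts_add\<close>), and
  \<open>adv_lower_boundI\<close> turns the certified closed ball into a bound on the infimum of
  adversarial distortions.\<close>

lemma lp_norm_nonneg: "0 \<le> lp_norm p x"
  by (simp add: lp_norm_def infnorm_pos_le)

text \<open>
  If \<open>L \<le> 0\<close> then \<open>g\<close> is constant. This covers the junk values of the quotient.
\<close>

lemma lp_Lipschitz_nonneg_add:
  assumes lip: "lp_Lipschitz p g L"
    and "0 \<le> g x"
    and le: "ereal (lp_norm p \<delta>) \<le> ereal (g x) / ereal L"
  shows "0 \<le> g (x + \<delta>)"
proof -
  have "\<bar>g (x + \<delta>) - g x\<bar> \<le> L * lp_norm p (x + \<delta> - x)"
    using lip unfolding lp_Lipschitz_def by blast
  then have step: "\<bar>g (x + \<delta>) - g x\<bar> \<le> L * lp_norm p \<delta>"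
    by simp
  show ?thesis
  proof (cases "L \<le> 0")
    case True
    then have "L * lp_norm p \<delta> \<le> 0"
      by (simp add: lp_norm_nonneg mult_nonpos_nonneg)
    with step \<open>0 \<le> g x\<close> show ?thesis by linarith
  next
    case False
    \<comment> \<open>For \<open>L > 0\<close> the extended quotient is the real number
      \<open>g x / L\<close>, so \<open>le\<close> can be multiplied out.\<close>
    with le have "L * lp_norm p \<delta> \<le> g x"
      by (simp add: pos_le_divide_eq mult.commute)
    with step show ?thesis by linarith
  qed
qed

lemma predicts_iff: "predicts f x c \<longleftrightarrow> (\<forall>j. f x $ j \<le> f x $ c)"
  by (auto simp: predicts_def is_arg_max_def not_less)

text \<open>Since ties count as predictions, staying a maximizer amounts to one weak sign condition
  on \<open>f_c - f_j\<close> per class, and the minimum in \<open>margin_bound\<close> supplies the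
  radius needed for each of them.\<close>

lemma predicts_add:
  assumes pred: "predicts f x0 c"
    and lip: "\<And>j. j \<noteq> c \<Longrightarrow> lp_Lipschitz p (\<lambda>x. f x $ c - f x $ j) (L j)"
    and le: "ereal (lp_norm p \<delta>) \<le> margin_bound f c L x0"
  shows "predicts f (x0 + \<delta>) c"
  unfolding predicts_iff
proof
  fix j
  show "f (x0 + \<delta>) $ j \<le> f (x0 + \<delta>) $ c"
  proof (cases "j = c")
    case False
    have "margin_bound f c L x0 \<le> ereal (f x0 $ c - f x0 $ j) / ereal (L j)"
      unfolding margin_bound_def using False by (intro INF_lower) simp
    with le have "ereal (lp_norm p \<delta>) \<le> ereal (f x0 $ c - f x0 $ j) / ereal (L j)"
      by (rule order_trans)
    moreover have "0 \<le> f x0 $ c - f x0 $ j"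
      using pred by (simp add: predicts_iff)
    ultimately have "0 \<le> f (x0 + \<delta>) $ c - f (x0 + \<delta>) $ j"
      using lp_Lipschitz_nonneg_add[OF lip[OF False]] by blast
    then show ?thesis by simp
  qed simp
qed

text \<open>By contraposition in the linear order of \<open>ereal\<close>, every adversarial
  distortion exceeds \<open>\<beta>\<close>, so \<open>\<beta>\<close> is below their infimum,
  including the value \<open>\<infinity>\<close> of an empty one.\<close>

lemma adv_lower_boundI:
  assumes "\<And>\<delta>. ereal (lp_norm p \<delta>) \<le> \<beta> \<Longrightarrow> \<not> adversarial f c x0 \<delta>"
  shows "adv_lower_bound p f c x0 \<beta>"
proof -
  have "\<beta> \<le> min_adv_distortion p f c x0"
    unfolding min_adv_distortion_def
  proof (rule INF_greatest)
    fix \<delta> assume "\<delta> \<in> {\<delta>. adversarial f c x0 \<delta>}"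
    with assms[of \<delta>] show "\<beta> \<le> ereal (lp_norm p \<delta>)"
      by (metis mem_Collect_eq linear)
  qed
  with assms show ?thesis
    by (simp add: adv_lower_bound_def)
qed

theorem theorem3p2:
  fixes f :: "real ^ 'd \<Rightarrow> real ^ 'k"
    and x0 :: "real ^ 'd"
    and c :: 'k
    and p q :: ereal
    and L :: "'k \<Rightarrow> real"
  assumes "\<And>i. cont_differentiable (\<lambda>x. f x $ i)"
    and "predicts f x0 c"
    and "1 \<le> p" and "1 \<le> q" and "1 / p + 1 / q = 1"
    and "\<And>j. j \<noteq> c \<Longrightarrow> lp_Lipschitz p (\<lambda>x. f x $ c - f x $ j) (L j)"
  shows "(\<forall>\<delta>. ereal (lp_norm p \<delta>) \<le> margin_bound f c L x0 \<longrightarrow> predicts f (x0 + \<delta>) c) \<and>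
         adv_lower_bound p f c x0 (margin_bound f c L x0)"
proof -
  have pred: "predicts f (x0 + \<delta>) c" if "ereal (lp_norm p \<delta>) \<le> margin_bound f c L x0" for \<delta>
    using assms(2,6) that by (rule predicts_add)
  then have "adv_lower_bound p f c x0 (margin_bound f c L x0)"
    by (intro adv_lower_boundI) (simp add: adversarial_def)
  with pred show ?thesis by blast
qed

end
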